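(* The Cholesky root count of a diagonal matrix over $\mathbb F_2$ is not determined solely by its rank or nullity: there exist two diagonal matrices $D,E$ of the same size over $\mathbb F_2$ with the same rank and the same nullity such that $\nu(D)\neq\nu(E)$.
   Context: For a symmetric $n\times n$ matrix $A$ over $\mathbb F_2$, the Cholesky root count $\nu(A)$ is the number of $n\times n$ upper triangular matrices $U$ over $\mathbb F_2$ (not necessarily invertible) with $U^TU=A$. *)

theory Defs
  imports
    "HOL-Library.Z2"
    "Jordan_Normal_Form.DL_Rank"
    "Jordan_Normal_Form.Matrix_Kernel"
begin

(* The field F_2 is the type bit. The count is meant for symmetric square A;
   an upper triangular root U need not be invertible. *)
definition cholesky_roots :: "bit mat \<Rightarrow> bit mat set" where
  "cholesky_roots A =
     {U \<in> carrier_mat (dim_row A) (dim_row A). upper_triangular U \<and> U\<^sup>T * U = A}"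

definition cholesky_root_count :: "bit mat \<Rightarrow> nat" where
  "cholesky_root_count A = card (cholesky_roots A)"

end

theory Submission
  imports Defs
begin

text \<open>
  Size two already separates the counts, with the two ways of placing a single \<open>1\<close> on the
  diagonal. For \<open>U\<close> with rows \<open>(a, b)\<close> and \<open>(0, c)\<close>, the rows of \<open>U\<^sup>T * U\<close> are \<open>(a, a * b)\<close>
  and \<open>(a * b, b + c)\<close>, since squaring is the identity on the field with two elements
  (\<open>gram_upper2_eq_diag_iff\<close>). If the \<open>1\<close> comes first, then \<open>a = 1\<close> forces \<open>b = 0\<close> and hence
  \<open>c = 0\<close>: there is one root. If it comes last, then \<open>a = 0\<close> and the vanishing of \<open>a * b\<close> does not
  constrain \<open>b\<close>, so only \<open>b + c = 1\<close> remains: there are two roots. The asymmetry comes from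
  triangularity: the first row of a root has an entry beyond its diagonal, which a zero pivot sets
  free, while the last row has none.

  Rank and nullity cannot see the order of the diagonal. The nullities agree because swapping the
  two coordinates is a similarity (\<open>kernel_dim_swap_diag2\<close>); both ranks are \<open>1\<close> because each matrix
  is a nonzero outer product (\<open>rank_product_entries_eq_1\<close>).
\<close>

definition upper2 :: "'a::zero \<Rightarrow> 'a \<Rightarrow> 'a \<Rightarrow> 'a mat" where
  "upper2 a b c = mat_of_rows_list 2 [[a, b], [0, c]]"

lemma dim_upper2 [simp]: "dim_row (upper2 a b c) = 2" "dim_col (upper2 a b c) = 2"
  by (simp_all add: upper2_def mat_of_rows_list_def)

lemma upper2_carrier [simp]: "upper2 a b c \<in> carrier_mat 2 2"
  by (intro carrier_matI) simp_all

lemma index_upper2 [simp]: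
  "upper2 a b c $$ (0, 0) = a" "upper2 a b c $$ (0, Suc 0) = b"
  "upper2 a b c $$ (Suc 0, 0) = 0" "upper2 a b c $$ (Suc 0, Suc 0) = c"
  by (simp_all add: upper2_def mat_of_rows_list_def)

lemma eq_mat2_iff:
  assumes "A \<in> carrier_mat 2 2" "B \<in> carrier_mat 2 2"
  shows "A = B \<longleftrightarrow> A $$ (0,0) = B $$ (0,0) \<and> A $$ (0,Suc 0) = B $$ (0,Suc 0) \<and>
    A $$ (Suc 0,0) = B $$ (Suc 0,0) \<and> A $$ (Suc 0,Suc 0) = B $$ (Suc 0,Suc 0)"
    (is "_ \<longleftrightarrow> ?entries")
proof
  assume ?entries
  then have "A $$ (i, j) = B $$ (i, j)" if "i < 2" "j < 2" for i j
    using that less_2_cases[of i] less_2_cases[of j] by auto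
  then show "A = B" using assms by (intro eq_matI) simp_all
qed simp

lemma index_mult_mat2:
  fixes A B :: "'a::semiring_0 mat"
  assumes "A \<in> carrier_mat 2 2" "B \<in> carrier_mat 2 2" "i < 2" "j < 2"
  shows "(A * B) $$ (i, j) = A $$ (i, 0) * B $$ (0, j) + A $$ (i, Suc 0) * B $$ (Suc 0, j)"
proof -
  have "{0..<2} = {0, Suc 0}" by auto
  then show ?thesis using assms by (simp add: scalar_prod_def)
qed

lemma upper2_eq_iff [simp]: "upper2 a b c = upper2 a' b' c' \<longleftrightarrow> a = a' \<and> b = b' \<and> c = c'"
  by (simp add: eq_mat2_iff)

lemma upper_triangular_upper2 [simp]: "upper_triangular (upper2 a b c)"
  by (auto simp: upper_triangular_def less_2_cases_iff)

lemma upper_triangular2E: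
  assumes "U \<in> carrier_mat 2 2" "upper_triangular U"
  obtains a b c where "U = upper2 a b c"
proof
  show "U = upper2 (U $$ (0,0)) (U $$ (0,Suc 0)) (U $$ (Suc 0,Suc 0))"
    using assms by (auto simp: eq_mat2_iff upper_triangular_def)
qed

text \<open>
  The diagonal entries of the Gram matrix are \<open>a\<^sup>2\<close> and \<open>b\<^sup>2 + c\<^sup>2\<close>. Over two
  elements \<open>x\<^sup>2 = x\<close>, which leaves one linear equation for each diagonal entry and \<open>a * b = 0\<close> for
  the off-diagonal ones.
\<close>

lemma gram_upper2_eq_diag_iff:
  fixes a b c p q :: bit
  shows "(upper2 a b c)\<^sup>T * upper2 a b c = upper2 p 0 q \<longleftrightarrow> a = p \<and> a * b = 0 \<and> b + c = q"
proof -
  have one2: "Suc 0 < 2" by simp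
  have sq: "x * x = x" for x :: bit by (cases x) auto
  have U: "(upper2 a b c)\<^sup>T \<in> carrier_mat 2 2" by simp
  then have Gram: "(upper2 a b c)\<^sup>T * upper2 a b c \<in> carrier_mat 2 2"
    by (rule mult_carrier_mat[OF _ upper2_carrier])
  have entry: "((upper2 a b c)\<^sup>T * upper2 a b c) $$ (i, j) =
      upper2 a b c $$ (0, i) * upper2 a b c $$ (0, j) +
      upper2 a b c $$ (Suc 0, i) * upper2 a b c $$ (Suc 0, j)" if "i < 2" "j < 2" for i j
    using that by (subst index_mult_mat2[OF U upper2_carrier]) simp_all
  have "(upper2 a b c)\<^sup>T * upper2 a b c = upper2 p 0 q \<longleftrightarrow>
      a = p \<and> a * b = 0 \<and> b * a = 0 \<and> b + c = q"
    unfolding eq_mat2_iff[OF Gram upper2_carrier]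
      entry[OF pos2 pos2] entry[OF pos2 one2] entry[OF one2 pos2] entry[OF one2 one2]
      index_upper2 sq mult_zero_left mult_zero_right add_0_right ..
  then show ?thesis unfolding mult.commute[of b a] by blast
qed

lemma cholesky_roots_diag2:
  "cholesky_roots (upper2 p 0 q) = {upper2 p b c | b c. p * b = 0 \<and> b + c = q}"
proof (intro equalityI subsetI)
  fix U assume "U \<in> cholesky_roots (upper2 p 0 q)"
  then have "U \<in> carrier_mat 2 2" "upper_triangular U" and gram: "U\<^sup>T * U = upper2 p 0 q"
    by (simp_all add: cholesky_roots_def)
  then obtain a b c where "U = upper2 a b c" by (elim upper_triangular2E)
  with gram show "U \<in> {upper2 p b c | b c. p * b = 0 \<and> b + c = q}"
    by (auto simp only: gram_upper2_eq_diag_iff)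
next
  fix U assume "U \<in> {upper2 p b c | b c. p * b = 0 \<and> b + c = q}"
  then obtain b c where U: "U = upper2 p b c" and "p * b = 0" "b + c = q" by blast
  then have "U\<^sup>T * U = upper2 p 0 q" by (simp only: gram_upper2_eq_diag_iff simp_thms)
  then show "U \<in> cholesky_roots (upper2 p 0 q)" by (simp add: cholesky_roots_def U)
qed

lemma cholesky_root_count_diag_1_0: "cholesky_root_count (upper2 1 0 0) = 1"
proof -
  have "cholesky_roots (upper2 1 0 0) = {upper2 1 0 0}"
    by (auto simp: cholesky_roots_diag2)
  then show ?thesis by (simp add: cholesky_root_count_def)
qed

lemma cholesky_root_count_diag_0_1: "cholesky_root_count (upper2 0 0 1) = 2"
proof -
  have "cholesky_roots (upper2 0 0 1) = {upper2 0 0 1, upper2 0 1 0}"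
  proof -
    have "b + c = 1 \<longleftrightarrow> (b = 0 \<and> c = 1) \<or> (b = 1 \<and> c = 0)" for b c :: bit
      by (cases b; cases c) auto
    then show ?thesis by (auto simp: cholesky_roots_diag2)
  qed
  then show ?thesis by (simp add: cholesky_root_count_def)
qed

text \<open>
  Conjugating by the permutation matrix that swaps the two coordinates exchanges the diagonal
  entries, and similar matrices have kernels of the same dimension.
\<close>

lemma kernel_dim_swap_diag2:
  fixes p q :: "'a::field"
  shows "kernel_dim (upper2 p 0 q) = kernel_dim (upper2 q 0 p)"
proof -
  let ?P = "swaprows_mat 2 0 (Suc 0) :: 'a mat"
  have P: "?P \<in> carrier_mat 2 2" by simp
  have PP: "?P * ?P = 1\<^sub>m 2" by (rule swaprows_mat_inv) simp_all
  have PU: "?P * upper2 q 0 p \<in> carrier_mat 2 2"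
    by (rule mult_carrier_mat[OF P upper2_carrier])
  have "similar_mat_wit (upper2 p 0 q) (upper2 q 0 p) ?P ?P"
  proof (rule similar_mat_witI[where n = 2])
    show "upper2 p 0 q = ?P * upper2 q 0 p * ?P"
      by (simp only: eq_mat2_iff[OF upper2_carrier mult_carrier_mat[OF PU P]])
        (simp add: index_mult_mat2[OF PU P] index_mult_mat2[OF P upper2_carrier]
          del: index_mult_mat(1))
  qed (use PP in simp_all)
  from similar_mat_wit_kernel_dim[OF upper2_carrier this] show ?thesis
    by (simp add: kernel_dim_def)
qed

text \<open>
  An outer product has all its columns on one line, which bounds the rank by \<open>1\<close>; a nonzero entry
  makes its column a linearly independent singleton, which gives the other bound.
\<close>

lemma (in vec_space) rank_product_entries_eq_1:
  fixes f g :: "nat \<Rightarrow> 'a"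
  assumes A: "A \<in> carrier_mat n nc"
    and entries: "\<And>r c. r < n \<Longrightarrow> c < nc \<Longrightarrow> A $$ (r, c) = f r * g c"
    and nz: "i < n" "j < nc" "A $$ (i, j) \<noteq> 0"
  shows "rank A = 1"
proof (rule antisym)
  show "rank A \<le> 1"
    by (rule rank_le_1_product_entries[OF A]) (use A entries in auto)
next
  have col: "col A j \<in> carrier_vec n" using A by auto
  have "col A j $ i \<noteq> 0" using A nz by simp
  then have "col A j \<noteq> 0\<^sub>v n" using nz(1) by auto
  then have "col A j \<notin> span {}" using span_empty by simp
  moreover have "lin_indpt {}" by (auto simp: lin_dep_def)
  ultimately have "lin_indpt {col A j}"
    using lin_dep_iff_in_span[of "{}" "col A j"] col by simp
  moreover have "{col A j} \<subseteq> set (cols A)"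
    using A nz(2) by (auto simp: cols_def)
  ultimately show "1 \<le> rank A"
    using rank_ge_card_indpt[OF A, of "{col A j}"] by simp
qed

lemma rank_diag2_eq_1:
  "vec_space.rank 2 (upper2 1 0 (0 :: 'a::field)) = 1"
  "vec_space.rank 2 (upper2 0 0 (1 :: 'a)) = 1"
proof -
  \<comment> \<open>A matrix unit on the diagonal is the outer product of a unit vector with itself.\<close>
  let ?e = "\<lambda>(k::nat) i. of_bool (i = k) :: 'a"
  show "vec_space.rank 2 (upper2 1 0 (0 :: 'a)) = 1"
    by (rule vec_space.rank_product_entries_eq_1[of _ _ 2 "?e 0" "?e 0" 0 0])
      (auto simp: less_2_cases_iff)
  show "vec_space.rank 2 (upper2 0 0 (1 :: 'a)) = 1"
    by (rule vec_space.rank_product_entries_eq_1[of _ _ 2 "?e 1" "?e 1" 1 1])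
      (auto simp: less_2_cases_iff)
qed

theorem corollary4p8:
  shows "\<exists>(n::nat) (D::bit mat) (E::bit mat).
    D \<in> carrier_mat n n \<and> diagonal_mat D \<and>
    E \<in> carrier_mat n n \<and> diagonal_mat E \<and>
    vec_space.rank n D = vec_space.rank n E \<and>
    kernel_dim D = kernel_dim E \<and>
    cholesky_root_count D \<noteq> cholesky_root_count E"
proof (intro exI conjI)
  show "diagonal_mat (upper2 1 0 (0::bit))" "diagonal_mat (upper2 0 0 (1::bit))"
    by (auto simp: diagonal_mat_def less_2_cases_iff)
  show "vec_space.rank 2 (upper2 1 0 (0::bit)) = vec_space.rank 2 (upper2 0 0 (1::bit))"
    by (simp add: rank_diag2_eq_1)
  show "kernel_dim (upper2 1 0 (0::bit)) = kernel_dim (upper2 0 0 (1::bit))"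
    by (rule kernel_dim_swap_diag2)
  show "cholesky_root_count (upper2 1 0 0) \<noteq> cholesky_root_count (upper2 0 0 1)"
    by (simp add: cholesky_root_count_diag_1_0 cholesky_root_count_diag_0_1)
qed simp_all

end
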